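(* Consider the overlaid primary and secondary networks on the unit square operating under the primary and secondary protocols described in the context. Then: 1) The opportunistic factor $\eta$ of a secondary cell satisfies $\frac{9}{25}\le\eta\le\frac{16}{25}$, for $n$ large enough. 2) Each individual secondary node has a finite (i.e. nonzero) opportunity to transmit its packets to the chosen destination, i.e., there is zero outage, w.h.p.
   Context: W.h.p. means with probability tending to 1 as $n\to\infty$. "$n$ large enough" means that, for fixed $\beta$, $n$ is chosen so that $a_s\ll a_p$. Network model. Primary nodes form a Poisson point process of density $n$ on the unit square and secondary nodes a Poisson point process of density $m=n^\beta$, $\beta>1$. Nodes of each network are randomly grouped into one-to-one source-destination (S-D) pairs. TX and RX stand for transmitter and receiver. Primary protocol. The unit square is divided into square primary cells of area $a_p=\frac{k_1\log n}{n}$, $k_1\ge1$, grouped into clusters of $25$ ($5\times5$) cells. Time is split into TDMA frames of 25 slots, each of length $t_p$; in each slot one cell per cluster is active, cells taking turns in round-robin fashion, with the same pattern in all clusters. The data path of an S-D pair is the horizontal line followed by the vertical line connecting source to destination. In each cell one node is the designated relay node (nodes take turns). When a cell is active, its slot is divided into packet slots, one for each data path passing through or originating from the cell: the relay transmits one packet for each path passing through the cell, then each source in the cell transmits one packet. Each packet goes to the relay node of the neighboring cell along the data path, or directly to the destination if that is the next hop (the destination may be in the same or a neighboring cell). Received packets are buffered and sent in the next active slot of the cell. Secondary protocol. Same construction with square secondary cells of area $a_s=\frac{k_2\log m}{m}$, $k_2=k_1\ge1$, clusters of 25 cells, 25-slot TDMA, horizontal-then-vertical data paths and relay nodes; one secondary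 TDMA frame has the duration $t_p$ of one primary slot. Around each primary cell containing an active primary TX there is a preservation region, a square of $M^2$ secondary cells, $M=\lfloor 3\sqrt{a_p/a_s}\rfloor+2$ (i.e. covering the $3\times3$ block of primary cells around the active one plus a protective strip of width $\sqrt{a_s}$), in which no secondary node may transmit (but may receive). A relay node in a preservation region buffers packets until the region is cleared and its cell is active. The active region is the part of the unit square not covered by preservation regions; it changes with the active slot of the primary TDMA frame. The opportunistic factor of a secondary cell is the fraction of time in which it is located in the active region. An outage event occurs when a node has zero opportunity to communicate; the outage probability is the fraction of nodes that have zero opportunity to communicate.
   Formalization: The bound η ≤ 16/25 is false near the edge of the square (21/25 at a corner), so it is claimed only for secondary cells not inside the outermost layer of primary cells, and either w.h.p. or when every primary cell contains a TX; cells per side are rounded to a multiple of 5. *)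

theory Defs
  imports "HOL-Probability.Probability"
begin

type_synonym point = "real \<times> real"
type_synonym cell = "int \<times> int"


section \<open>Square grids and TDMA schedules\<close>

definition unit_square :: "point set" where
  "unit_square = {0..<1} \<times> {0..<1}"

text \<open>The nominal cell area for density \<open>d\<close> is \<open>k * ln d / d\<close>.  The number of cells per side is
  rounded down to a multiple of 5, so that the cells tile the unit square exactly and the grid splits
  into complete clusters of \<open>5 \<times> 5\<close> cells.  The actual cell area is at least the nominal area and
  asymptotically equal to it.\<close>

definition cells_per_side :: "real \<Rightarrow> real \<Rightarrow> int" where
  "cells_per_side k d = 5 * \<lfloor>1 / (5 * sqrt (k * ln d / d))\<rfloor>"

definition cell_side :: "real \<Rightarrow> real \<Rightarrow> real" where
  "cell_side k d = 1 / real_of_int (cells_per_side k d)"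

definition grid_cells :: "int \<Rightarrow> cell set" where
  "grid_cells g = {0..<g} \<times> {0..<g}"

text \<open>The square made of the \<open>l \<times> l\<close> cells of side \<open>s\<close> whose lower left cell is \<open>c\<close>; it may extend
  beyond the unit square.\<close>

definition cell_block :: "real \<Rightarrow> cell \<Rightarrow> int \<Rightarrow> point set" where
  "cell_block s c l =
     {of_int (fst c) * s ..< of_int (fst c + l) * s} \<times> {of_int (snd c) * s ..< of_int (snd c + l) * s}"

definition cell_square :: "real \<Rightarrow> cell \<Rightarrow> point set" where
  "cell_square s c = cell_block s c 1"

definition cell_of :: "real \<Rightarrow> point \<Rightarrow> cell" where
  "cell_of s x = (\<lfloor>fst x / s\<rfloor>, \<lfloor>snd x / s\<rfloor>)"

text \<open>A turn order numbers the 25 positions inside a cluster; it is the same for all clusters.\<close>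

definition turn_order :: "(cell \<Rightarrow> nat) \<Rightarrow> bool" where
  "turn_order r \<longleftrightarrow> bij_betw r ({0..<5} \<times> {0..<5}) {..<25}"

definition active_in_slot :: "(cell \<Rightarrow> nat) \<Rightarrow> cell \<Rightarrow> nat \<Rightarrow> bool" where
  "active_in_slot r c t \<longleftrightarrow> r (fst c mod 5, snd c mod 5) = t mod 25"


section \<open>Networks, data paths and relays\<close>

text \<open>A realization of a network: the nodes are the labels \<open>i < num_nodes N\<close>, and node \<open>i\<close> is the source
  of the S-D pair with destination \<open>dest N i\<close>.\<close>

record network =
  num_nodes :: nat
  pos :: "nat \<Rightarrow> point"
  dest :: "nat \<Rightarrow> nat"

definition node_cell :: "real \<Rightarrow> network \<Rightarrow> nat \<Rightarrow> cell" where
  "node_cell s N i = cell_of s (pos N i)"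

definition occupied :: "real \<Rightarrow> network \<Rightarrow> cell \<Rightarrow> bool" where
  "occupied s N c \<longleftrightarrow> (\<exists>i < num_nodes N. node_cell s N i = c)"

definition next_cell :: "cell \<Rightarrow> cell \<Rightarrow> cell" where
  "next_cell d c =
     (if fst c \<noteq> fst d then (fst c + sgn (fst d - fst c), snd c)
      else (fst c, snd c + sgn (snd d - snd c)))"

definition path_cell :: "real \<Rightarrow> network \<Rightarrow> nat \<Rightarrow> nat \<Rightarrow> cell" where
  "path_cell s N i j = (next_cell (node_cell s N (dest N i)) ^^ j) (node_cell s N i)"

text \<open>The packets of source \<open>i\<close> are transmitted in the cells \<open>path_cell s N i j\<close> with
  \<open>j < path_hops s N i\<close>: by the source itself for \<open>j = 0\<close> and by the relay of the cell for \<open>j > 0\<close>.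
  The last transmission goes directly to the destination; there is one transmission when source and
  destination lie in the same cell.\<close>

definition path_hops :: "real \<Rightarrow> network \<Rightarrow> nat \<Rightarrow> nat" where
  "path_hops s N i =
     (let c = node_cell s N i; d = node_cell s N (dest N i)
      in max 1 (nat (\<bar>fst d - fst c\<bar> + \<bar>snd d - snd c\<bar>)))"

text \<open>Some node of the cell transmits when the cell is active: a data path originates from the cell, or
  passes through it and the cell has a node to serve as relay.\<close>

definition contains_TX :: "real \<Rightarrow> network \<Rightarrow> cell \<Rightarrow> bool" where
  "contains_TX s N c \<longleftrightarrow>
     (\<exists>i < num_nodes N. \<exists>j < path_hops s N i. path_cell s N i j = c \<and> occupied s N c)"


section \<open>The random networks\<close>

definition node_count :: "network \<Rightarrow> point set \<Rightarrow> nat" where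
  "node_count N A = card {i. i < num_nodes N \<and> pos N i \<in> A}"

definition poisson_point_process :: "'w measure \<Rightarrow> real \<Rightarrow> ('w \<Rightarrow> network) \<Rightarrow> bool" where
  "poisson_point_process M d \<Phi> \<longleftrightarrow>
     prob_space M \<and>
     (\<forall>i. (\<lambda>\<omega>. pos (\<Phi> \<omega>) i) \<in> borel_measurable M) \<and>
     (\<forall>\<omega> \<in> space M. \<forall>i < num_nodes (\<Phi> \<omega>). pos (\<Phi> \<omega>) i \<in> unit_square) \<and>
     (\<forall>A \<in> sets borel. A \<subseteq> unit_square \<longrightarrow>
        (\<lambda>\<omega>. node_count (\<Phi> \<omega>) A) \<in> measurable M (count_space UNIV) \<and>
        (\<forall>j. measure M {\<omega> \<in> space M. node_count (\<Phi> \<omega>) A = j} =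
             (d * measure lborel A) ^ j / fact j * exp (- (d * measure lborel A)))) \<and>
     (\<forall>F. finite F \<and> F \<subseteq> {A \<in> sets borel. A \<subseteq> unit_square} \<and> disjoint F \<longrightarrow>
        prob_space.indep_vars M (\<lambda>_. count_space UNIV) (\<lambda>A \<omega>. node_count (\<Phi> \<omega>) A) F)"

text \<open>Every node is the source of one pair and the destination of one pair, and no node is paired with
  itself (unless it is the only node).\<close>

definition sd_pairings :: "nat \<Rightarrow> (nat \<Rightarrow> nat) set" where
  "sd_pairings k = {p. p permutes {..<k} \<and> (2 \<le> k \<longrightarrow> (\<forall>i < k. p i \<noteq> i))}"

text \<open>Given the number of nodes and their positions, the pairing is uniformly distributed.\<close>

definition random_sd_pairing :: "'w measure \<Rightarrow> ('w \<Rightarrow> network) \<Rightarrow> bool" where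
  "random_sd_pairing M \<Phi> \<longleftrightarrow>
     (\<forall>\<omega> \<in> space M. dest (\<Phi> \<omega>) \<in> sd_pairings (num_nodes (\<Phi> \<omega>))) \<and>
     (\<forall>p. {\<omega> \<in> space M. dest (\<Phi> \<omega>) = p} \<in> sets M) \<and>
     (\<forall>k. \<forall>p \<in> sd_pairings k. \<forall>A. (\<forall>i < k. A i \<in> sets borel) \<longrightarrow>
        measure M {\<omega> \<in> space M. num_nodes (\<Phi> \<omega>) = k \<and> (\<forall>i < k. pos (\<Phi> \<omega>) i \<in> A i) \<and> dest (\<Phi> \<omega>) = p} =
        measure M {\<omega> \<in> space M. num_nodes (\<Phi> \<omega>) = k \<and> (\<forall>i < k. pos (\<Phi> \<omega>) i \<in> A i)}
          / card (sd_pairings k))"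

definition random_network :: "'w measure \<Rightarrow> real \<Rightarrow> ('w \<Rightarrow> network) \<Rightarrow> bool" where
  "random_network M d \<Phi> \<longleftrightarrow> poisson_point_process M d \<Phi> \<and> random_sd_pairing M \<Phi>"

definition whp :: "(nat \<Rightarrow> 'w measure) \<Rightarrow> (nat \<Rightarrow> 'w \<Rightarrow> bool) \<Rightarrow> bool" where
  "whp M P \<longleftrightarrow> (\<lambda>n. measure (M n) {\<omega> \<in> space (M n). P n \<omega>}) \<longlonglongrightarrow> 1"


section \<open>The overlaid protocols\<close>

text \<open>\<open>region_corner Q p\<close> is the lower left secondary cell of the preservation region around the primary
  cell \<open>p\<close>.\<close>

record protocol =
  primary_const :: real
  primary_density :: real
  secondary_const :: real
  secondary_density :: real
  primary_turn :: "cell \<Rightarrow> nat"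
  secondary_turn :: "cell \<Rightarrow> nat"
  region_corner :: "cell \<Rightarrow> cell"

definition primary_side :: "protocol \<Rightarrow> real" where
  "primary_side Q = cell_side (primary_const Q) (primary_density Q)"

definition secondary_side :: "protocol \<Rightarrow> real" where
  "secondary_side Q = cell_side (secondary_const Q) (secondary_density Q)"

definition primary_cells :: "protocol \<Rightarrow> cell set" where
  "primary_cells Q = grid_cells (cells_per_side (primary_const Q) (primary_density Q))"

definition secondary_cells :: "protocol \<Rightarrow> cell set" where
  "secondary_cells Q = grid_cells (cells_per_side (secondary_const Q) (secondary_density Q))"

definition region_size :: "protocol \<Rightarrow> int" where
  "region_size Q = \<lfloor>3 * sqrt ((primary_side Q)\<^sup>2 / (secondary_side Q)\<^sup>2)\<rfloor> + 2"

definition preservation_region :: "protocol \<Rightarrow> cell \<Rightarrow> point set" where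
  "preservation_region Q p = cell_block (secondary_side Q) (region_corner Q p) (region_size Q)"

text \<open>The region is a square of \<open>region_size Q \<times> region_size Q\<close> secondary cells, hence aligned with the
  secondary grid.  Since the primary grid need not be aligned with it, the region cannot be centred
  exactly; any position covering the \<open>3 \<times> 3\<close> block of primary cells around \<open>p\<close> is allowed.  The
  region exceeds this block by more than one and at most two secondary cell sides in each direction.\<close>

definition valid_protocol :: "protocol \<Rightarrow> bool" where
  "valid_protocol Q \<longleftrightarrow>
     turn_order (primary_turn Q) \<and> turn_order (secondary_turn Q) \<and>
     (\<forall>p \<in> primary_cells Q.
        cell_block (primary_side Q) (fst p - 1, snd p - 1) 3 \<subseteq> preservation_region Q p)"

text \<open>Primary slots are numbered consecutively by \<open>t\<close>, and 25 consecutive primary slots form a frame.\<close>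

definition active_region :: "protocol \<Rightarrow> network \<Rightarrow> nat \<Rightarrow> point set" where
  "active_region Q P t =
     unit_square -
     (\<Union>p \<in> {p \<in> primary_cells Q. active_in_slot (primary_turn Q) p t \<and>
                                   contains_TX (primary_side Q) P p}. preservation_region Q p)"

definition in_active_region :: "protocol \<Rightarrow> network \<Rightarrow> cell \<Rightarrow> nat \<Rightarrow> bool" where
  "in_active_region Q P c t \<longleftrightarrow> cell_square (secondary_side Q) c \<subseteq> active_region Q P t"

text \<open>The active region is the same in every primary frame, so the fraction of time is the fraction of
  the slots of one frame.\<close>

definition opportunistic_factor :: "protocol \<Rightarrow> network \<Rightarrow> cell \<Rightarrow> real" where
  "opportunistic_factor Q P c = card {t. t < 25 \<and> in_active_region Q P c t} / 25"

text \<open>Secondary slots are numbered consecutively by \<open>u\<close>; the secondary frame \<open>u div 25\<close> takes place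
  during the primary slot with the same number.\<close>

definition may_transmit :: "protocol \<Rightarrow> network \<Rightarrow> cell \<Rightarrow> nat \<Rightarrow> bool" where
  "may_transmit Q P c u \<longleftrightarrow>
     active_in_slot (secondary_turn Q) c u \<and> in_active_region Q P c (u div 25)"

text \<open>A secondary node has a nonzero opportunity if, starting at any time, a packet of the node gets to
  its destination: there are successive secondary slots for all the transmissions along the data path,
  and all intermediate cells have a relay.  Within a slot of a cell, every data path using the cell gets
  a packet slot.\<close>

definition has_opportunity :: "protocol \<Rightarrow> network \<Rightarrow> network \<Rightarrow> nat \<Rightarrow> bool" where
  "has_opportunity Q P S i \<longleftrightarrow>
     (\<forall>u0. \<exists>u :: nat \<Rightarrow> nat. u0 \<le> u 0 \<and>
        (\<forall>j. Suc j < path_hops (secondary_side Q) S i \<longrightarrow> u j < u (Suc j)) \<and>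
        (\<forall>j < path_hops (secondary_side Q) S i.
           may_transmit Q P (path_cell (secondary_side Q) S i j) (u j) \<and>
           occupied (secondary_side Q) S (path_cell (secondary_side Q) S i j)))"

definition outage_probability :: "protocol \<Rightarrow> network \<Rightarrow> network \<Rightarrow> real" where
  "outage_probability Q P S =
     card {i. i < num_nodes S \<and> \<not> has_opportunity Q P S i} / num_nodes S"

text \<open>The secondary cell is not contained in the outermost layer of primary cells.  In that layer an
  edge effect occurs: for instance, a secondary cell in a corner primary cell is surrounded by only four
  primary cells instead of nine, and its opportunistic factor may be \<open>21 / 25\<close>.\<close>

definition off_boundary :: "protocol \<Rightarrow> cell \<Rightarrow> bool" where
  "off_boundary Q c \<longleftrightarrow>
     cell_square (secondary_side Q) c \<inter>
       ({primary_side Q ..< 1 - primary_side Q} \<times> {primary_side Q ..< 1 - primary_side Q}) \<noteq> {}"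

end

theory Submission
  imports Defs "HOL-Real_Asymp.Real_Asymp"
begin

text \<open>A preservation region exceeds the \<open>3 \<times> 3\<close> block of primary cells around its centre by at most two
  secondary sides, so once a secondary cell is small compared with a primary cell it meets the regions
  around at most \<open>4 \<times> 4\<close> primary cells, and at most 16 of the 25 slots are lost.  Conversely, off the
  boundary it meets the regions around a full \<open>3 \<times> 3\<close> block of primary cells, which take turns in 9
  different slots.  A cell of area at least \<open>k ln d / d\<close> with \<open>k \<ge> 1\<close> is empty with probability at most
  \<open>1 / d\<close>, and there are at most \<open>d / ln d\<close> cells, so w.h.p. no cell of either grid is empty.  Then every
  primary cell has a transmitter and every hop of a secondary path recurs in each primary frame.\<close>

section \<open>Blocked slots\<close>

lemma prod_atLeastLessThan_subset:
  fixes a b c d a' b' c' d' :: real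
  assumes "{a..<b} \<times> {a'..<b'} \<subseteq> {c..<d} \<times> {c'..<d'}" "a < b" "a' < b'"
  shows "c \<le> a" "b \<le> d" "c' \<le> a'" "b' \<le> d'"
proof -
  have "{a..<b} \<subseteq> {c..<d}" "{a'..<b'} \<subseteq> {c'..<d'}"
    using assms by (simp_all add: times_subset_iff)
  then show "c \<le> a" "b \<le> d" "c' \<le> a'" "b' \<le> d'"
    using assms(2,3) by simp_all
qed

section \<open>Extent of the preservation regions and the lower bound 9/25\<close>

lemma region_size_le:
  assumes "primary_side Q > 0" "secondary_side Q > 0"
  shows "of_int (region_size Q) * secondary_side Q \<le> 3 * primary_side Q + 2 * secondary_side Q"
proof -
  let ?a = "primary_side Q" and ?s = "secondary_side Q"
  have "sqrt (?a\<^sup>2 / ?s\<^sup>2) = ?a / ?s"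
    using assms by (simp add: real_sqrt_divide)
  then have "of_int (region_size Q) \<le> 3 * (?a / ?s) + 2"
    unfolding region_size_def by simp
  then have "of_int (region_size Q) * ?s \<le> (3 * (?a / ?s) + 2) * ?s"
    using assms by (intro mult_right_mono) auto
  also have "\<dots> = 3 * ?a + 2 * ?s" using assms by (simp add: algebra_simps)
  finally show ?thesis .
qed

text \<open>The region has side at most \<open>3 * a + 2 * s\<close> and covers a block of side
  \<open>3 * a\<close>. Wherever its corner lies, it therefore protrudes by at most
  \<open>2 * s\<close> on any one side of the block.\<close>

lemma preservation_region_bounds:
  assumes "valid_protocol Q" "p \<in> primary_cells Q" "x \<in> preservation_region Q p"
    and a: "primary_side Q > 0" and s: "secondary_side Q > 0"
  shows "(of_int (fst p) - 1) * primary_side Q - 2 * secondary_side Q \<le> fst x"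
    "fst x < (of_int (fst p) + 2) * primary_side Q + 2 * secondary_side Q"
    "(of_int (snd p) - 1) * primary_side Q - 2 * secondary_side Q \<le> snd x"
    "snd x < (of_int (snd p) + 2) * primary_side Q + 2 * secondary_side Q"
proof -
  let ?a = "primary_side Q" and ?s = "secondary_side Q"
  let ?r = "region_corner Q p" and ?M = "region_size Q"
  have sub: "{of_int (fst p - 1) * ?a ..< of_int (fst p - 1 + 3) * ?a} \<times>
      {of_int (snd p - 1) * ?a ..< of_int (snd p - 1 + 3) * ?a} \<subseteq>
      {of_int (fst ?r) * ?s ..< of_int (fst ?r + ?M) * ?s} \<times>
      {of_int (snd ?r) * ?s ..< of_int (snd ?r + ?M) * ?s}"
    using assms(1,2) unfolding valid_protocol_def cell_block_def preservation_region_def by auto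
  have lt: "of_int (fst p - 1) * ?a < of_int (fst p - 1 + 3) * ?a"
    "of_int (snd p - 1) * ?a < of_int (snd p - 1 + 3) * ?a"
    using a by (auto simp: algebra_simps)
  note 1 = prod_atLeastLessThan_subset[OF sub lt]
  note 2 = region_size_le[OF a s]
  have 3: "of_int (fst ?r) * ?s \<le> fst x" "fst x < of_int (fst ?r + ?M) * ?s"
    "of_int (snd ?r) * ?s \<le> snd x" "snd x < of_int (snd ?r + ?M) * ?s"
    using assms(3) unfolding preservation_region_def cell_block_def by auto
  show "(of_int (fst p) - 1) * ?a - 2 * ?s \<le> fst x"
    "fst x < (of_int (fst p) + 2) * ?a + 2 * ?s"
    "(of_int (snd p) - 1) * ?a - 2 * ?s \<le> snd x"
    "snd x < (of_int (snd p) + 2) * ?a + 2 * ?s"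
    using 1 2 3 by (simp_all add: algebra_simps)
qed

text \<open>An open interval of length 4 holds at most four integers. As both inequalities are
  strict, the same window of four serves whether or not \<open>L\<close> is an integer.\<close>

lemma int_in_window:
  fixes p :: int and L :: real
  assumes "L < of_int p" "of_int p < L + 4"
  shows "p \<in> {\<lfloor>L\<rfloor> + 1 .. \<lfloor>L\<rfloor> + 4}"
  using assms by (simp, linarith)

text \<open>In units of \<open>a\<close>, the two constraints put \<open>p\<close> strictly between
  \<open>(c - 2) * s / a - 2\<close> and \<open>(c + 3) * s / a + 1\<close>. This interval has
  length \<open>3 + 5 * s / a\<close>, which is below 4. The 5 is the width of the secondary cell
  plus a protrusion of 2 on either side.\<close>

lemma near_cell_index:
  fixes p c :: int and a s x :: real
  assumes "0 < a" "5 * s < a"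
    and "(of_int p - 1) * a - 2 * s \<le> x" "x < (of_int p + 2) * a + 2 * s"
    and "of_int c * s \<le> x" "x < of_int (c + 1) * s"
  shows "p \<in> {\<lfloor>(of_int c - 2) * s / a - 2\<rfloor> + 1 .. \<lfloor>(of_int c - 2) * s / a - 2\<rfloor> + 4}"
proof (rule int_in_window)
  have "(of_int c - 2) * s < (of_int p + 2) * a"
    using assms by (simp add: algebra_simps)
  then show "(of_int c - 2) * s / a - 2 < of_int p"
    using assms(1) by (simp add: field_simps)
  have "of_int p * a < (of_int c + 3) * s + a"
    using assms by (simp add: algebra_simps)
  also have "\<dots> < (of_int c - 2) * s + 2 * a"
    using assms by (simp add: algebra_simps)
  finally show "of_int p < (of_int c - 2) * s / a - 2 + 4"
    using assms(1) by (simp add: field_simps)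
qed

lemma cell_square_subset_unit_square:
  assumes "c \<in> grid_cells g"
  shows "cell_square (1 / of_int g) c \<subseteq> unit_square"
proof -
  have c: "0 \<le> fst c" "fst c + 1 \<le> g" "0 \<le> snd c" "snd c + 1 \<le> g"
    using assms by (auto simp: grid_cells_def)
  then have g: "0 < g" by linarith
  have upper: "of_int (i + 1) * (1 / of_int g) \<le> (1 :: real)" if "i + 1 \<le> g" for i
  proof -
    have "real_of_int (i + 1) \<le> of_int g" using that by (simp only: of_int_le_iff)
    then show ?thesis using g by simp
  qed
  have lower: "0 \<le> of_int i * (1 / real_of_int g)" if "0 \<le> i" for i
    using that g by simp
  show ?thesis
    unfolding cell_square_def cell_block_def unit_square_def
    using upper[OF c(2)] upper[OF c(4)] lower[OF c(1)] lower[OF c(3)]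
    by (intro Sigma_mono) (auto simp only: atLeastLessThan_iff intro: order_trans order_less_le_trans)
qed

lemma opportunistic_factor_alt:
  "opportunistic_factor Q P c = (25 - real (card {t. t < 25 \<and> \<not> in_active_region Q P c t})) / 25"
proof -
  let ?A = "{t. t < 25 \<and> in_active_region Q P c t}" and ?B = "{t. t < 25 \<and> \<not> in_active_region Q P c t}"
  have "card ?A + card ?B = card (?A \<union> ?B)" by (subst card_Un_disjoint) auto
  also have "?A \<union> ?B = {..<25}" by auto
  finally have "real (card ?A) = 25 - real (card ?B)" by simp
  then show ?thesis by (simp add: opportunistic_factor_def)
qed

text \<open>Every blocked slot is the turn of some primary cell in a fixed 4 by 4 window
  \<open>W\<close>. Counting the turns of all cells of \<open>W\<close>, transmitting or not, makes
  the bound valid for every primary network \<open>P\<close>.\<close>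

lemma opportunistic_factor_ge:
  assumes valid: "valid_protocol Q" and c: "c \<in> secondary_cells Q"
    and a: "primary_side Q > 0" and s: "secondary_side Q > 0"
    and small: "5 * secondary_side Q < primary_side Q"
  shows "opportunistic_factor Q P c \<ge> 9 / 25"
proof -
  let ?a = "primary_side Q" and ?s = "secondary_side Q"
  define w where "w i = {\<lfloor>(real_of_int i - 2) * ?s / ?a - 2\<rfloor> + 1 .. \<lfloor>(real_of_int i - 2) * ?s / ?a - 2\<rfloor> + 4}" for i
  define W where "W = w (fst c) \<times> w (snd c)"
  let ?turn = "\<lambda>p :: cell. primary_turn Q (fst p mod 5, snd p mod 5)"
  have W: "finite W" "card W = 16"
    by (auto simp: W_def w_def card_cartesian_product)
  have "{t. t < 25 \<and> \<not> in_active_region Q P c t} \<subseteq> ?turn ` W"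
  proof
    fix t assume "t \<in> {t. t < 25 \<and> \<not> in_active_region Q P c t}"
    then have t: "t < 25" "\<not> in_active_region Q P c t" by auto
    \<comment> \<open>The active region is a part of the unit square. A cell inside the unit square
      can leave it only by meeting a preservation region.\<close>
    have "cell_square ?s c \<subseteq> unit_square"
      using cell_square_subset_unit_square c
      unfolding secondary_side_def cell_side_def secondary_cells_def by blast
    then obtain x p where x: "x \<in> cell_square ?s c"
      and p: "p \<in> primary_cells Q" "active_in_slot (primary_turn Q) p t"
        "x \<in> preservation_region Q p"
      using t(2) unfolding in_active_region_def active_region_def by blast
    note bounds = preservation_region_bounds[OF valid p(1,3) a s]
    have "p \<in> W"
      unfolding W_def w_def mem_Times_iff
      using x bounds unfolding cell_square_def cell_block_def
      by (intro conjI near_cell_index[OF a small]) auto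
    moreover have "t = ?turn p"
      using p(2) t(1) unfolding active_in_slot_def by simp
    ultimately show "t \<in> ?turn ` W" by blast
  qed
  then have "card {t. t < 25 \<and> \<not> in_active_region Q P c t} \<le> card (?turn ` W)"
    using W(1) by (intro card_mono) auto
  also have "\<dots> \<le> 16" using card_image_le[OF W(1), of ?turn] W(2) by simp
  finally show ?thesis unfolding opportunistic_factor_alt by simp
qed

section \<open>The upper bound 16/25 away from the boundary\<close>

lemma inj_on_turn_window:
  assumes "turn_order r"
  shows "inj_on (\<lambda>p. r (fst p mod 5, snd p mod 5)) ({i - 1 .. i + 1} \<times> {j - 1 .. j + 1})"
proof (rule inj_onI, goal_cases)
  case (1 p q)
  have inj: "inj_on r ({0..<5} \<times> {0..<5})"
    using assms by (auto simp: turn_order_def bij_betw_def)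
  have "(fst p mod 5, snd p mod 5) = (fst q mod 5, snd q mod 5)"
    by (rule inj_onD[OF inj 1(3)]) auto
  then have "fst p mod 5 = fst q mod 5" "snd p mod 5 = snd q mod 5" by auto
  \<comment> \<open>Indices in the window differ by at most 2, so their residues mod 5 determine
    them, even if the window straddles several clusters.\<close>
  moreover have "\<bar>fst p - fst q\<bar> < 5" "\<bar>snd p - snd q\<bar> < 5"
    using 1(1,2) by auto
  ultimately have "fst p = fst q" "snd p = snd q" by presburger+
  then show ?case by (rule prod_eqI)
qed

text \<open>Choose a point \<open>x\<close> of the secondary cell outside the outermost primary
  layer, and let \<open>(i, j)\<close> be its primary cell. The nine cells around
  \<open>(i, j)\<close> all transmit, their regions all contain \<open>x\<close>, and their turns
  are distinct, so nine slots are blocked.\<close>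

lemma opportunistic_factor_le:
  assumes valid: "valid_protocol Q" and off: "off_boundary Q c"
    and a: "primary_side Q > 0"
    and TX: "\<forall>p \<in> primary_cells Q. contains_TX (primary_side Q) P p"
  shows "opportunistic_factor Q P c \<le> 16 / 25"
proof -
  let ?a = "primary_side Q"
  define G where "G = cells_per_side (primary_const Q) (primary_density Q)"
  have aG: "?a = 1 / of_int G" by (simp add: primary_side_def cell_side_def G_def)
  have G: "0 < G" using a by (simp add: aG)
  obtain x where x: "x \<in> cell_square (secondary_side Q) c"
    and x1: "?a \<le> fst x" "fst x < 1 - ?a" and x2: "?a \<le> snd x" "snd x < 1 - ?a"
    using off unfolding off_boundary_def by auto
  define i j where "i = \<lfloor>fst x / ?a\<rfloor>" and "j = \<lfloor>snd x / ?a\<rfloor>"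
  let ?B = "{i - 1 .. i + 1} \<times> {j - 1 .. j + 1}"
  let ?turn = "\<lambda>p :: cell. primary_turn Q (fst p mod 5, snd p mod 5)"
  \<comment> \<open>The first two bounds keep the neighbours of \<open>(i, j)\<close> inside the
    primary grid, and the last two locate \<open>x\<close> in its cell.\<close>
  have index: "1 \<le> \<lfloor>y / ?a\<rfloor>" "\<lfloor>y / ?a\<rfloor> + 1 < G"
      "of_int \<lfloor>y / ?a\<rfloor> * ?a \<le> y" "y < (of_int \<lfloor>y / ?a\<rfloor> + 1) * ?a"
    if "?a \<le> y" "y < 1 - ?a" for y
  proof -
    show "1 \<le> \<lfloor>y / ?a\<rfloor>" using that a by (simp add: le_floor_iff)
    have "y / ?a < of_int G - 1" using that a G by (simp add: aG field_simps)
    then show "\<lfloor>y / ?a\<rfloor> + 1 < G" by linarith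
    have "of_int \<lfloor>y / ?a\<rfloor> \<le> y / ?a" "y / ?a < of_int \<lfloor>y / ?a\<rfloor> + 1" by linarith+
    then show "of_int \<lfloor>y / ?a\<rfloor> * ?a \<le> y" "y < (of_int \<lfloor>y / ?a\<rfloor> + 1) * ?a"
      by (simp_all only: pos_le_divide_eq[OF a] pos_divide_less_eq[OF a])
  qed
  note I = index[OF x1, folded i_def] and J = index[OF x2, folded j_def]
  have turn: "turn_order (primary_turn Q)" using valid by (simp add: valid_protocol_def)
  have "?turn ` ?B \<subseteq> {t. t < 25 \<and> \<not> in_active_region Q P c t}"
  proof safe
    fix p1 p2 assume p: "p1 \<in> {i - 1 .. i + 1}" "p2 \<in> {j - 1 .. j + 1}"
    let ?p = "(p1, p2)" and ?t = "?turn (p1, p2)"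
    have "(p1 mod 5, p2 mod 5) \<in> {0..<5} \<times> {0..<5}" by auto
    then show t: "?t < 25"
      using turn unfolding turn_order_def bij_betw_def by fastforce
    have pc: "?p \<in> primary_cells Q"
      using p I(1,2) J(1,2) by (auto simp: primary_cells_def grid_cells_def G_def[symmetric])
    \<comment> \<open>One coordinate at a time: if \<open>p\<close> is within 1 of the index
      \<open>k\<close> of the cell containing \<open>y\<close>, then the three cells centred at
      \<open>p\<close> include that cell.\<close>
    have "of_int (p - 1) * ?a \<le> y \<and> y < of_int (p - 1 + 3) * ?a"
      if "p \<in> {k - 1 .. k + 1}" "of_int k * ?a \<le> y" "y < (of_int k + 1) * ?a" for p k y
    proof -
      have "of_int (p - 1) \<le> (of_int k :: real)" "of_int k + 1 \<le> (of_int (p - 1 + 3) :: real)"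
        using that(1) by auto
      then have "of_int (p - 1) * ?a \<le> of_int k * ?a" "(of_int k + 1) * ?a \<le> of_int (p - 1 + 3) * ?a"
        using a by (auto intro!: mult_right_mono)
      then show ?thesis using that by linarith
    qed
    from this[OF p(1) I(3,4)] this[OF p(2) J(3,4)]
    have "x \<in> cell_block ?a (p1 - 1, p2 - 1) 3"
      by (auto simp: cell_block_def mem_Times_iff)
    then have "x \<in> preservation_region Q ?p"
      using valid pc unfolding valid_protocol_def by fastforce
    moreover have "active_in_slot (primary_turn Q) ?p ?t"
      using t by (simp add: active_in_slot_def)
    moreover assume "in_active_region Q P c ?t"
    ultimately show False
      using x pc TX unfolding in_active_region_def active_region_def by blast
  qed
  then have "card (?turn ` ?B) \<le> card {t. t < 25 \<and> \<not> in_active_region Q P c t}"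
    by (intro card_mono) auto
  moreover have "card (?turn ` ?B) = 9"
    by (subst card_image[OF inj_on_turn_window[OF turn]]) (simp add: card_cartesian_product)
  ultimately show ?thesis unfolding opportunistic_factor_alt by simp
qed


section \<open>Data paths\<close>

lemma next_cell_in_grid:
  assumes "c \<in> grid_cells g" "d \<in> grid_cells g"
  shows "next_cell d c \<in> grid_cells g"
  using assms by (auto simp: next_cell_def grid_cells_def sgn_if)

lemma path_cell_in_grid:
  assumes "node_cell s N i \<in> grid_cells g" "node_cell s N (dest N i) \<in> grid_cells g"
  shows "path_cell s N i j \<in> grid_cells g"
  unfolding path_cell_def using assms by (induction j) (auto intro: next_cell_in_grid)

text \<open>Any node of the cell is itself a source. The \<open>max 1\<close> in
  \<open>path_hops\<close> guarantees that its hop 0 exists, even when its destination is in the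
  same cell.\<close>

lemma contains_TX_if_occupied:
  assumes "occupied s N c"
  shows "contains_TX s N c"
proof -
  obtain i where "i < num_nodes N" "node_cell s N i = c"
    using assms by (auto simp: occupied_def)
  moreover have "0 < path_hops s N i" by (auto simp: path_hops_def Let_def)
  moreover have "path_cell s N i 0 = node_cell s N i" by (simp add: path_cell_def)
  ultimately show ?thesis
    unfolding contains_TX_def using assms by metis
qed

lemma active_region_periodic: "active_region Q P (25 * q + t) = active_region Q P t"
  by (simp add: active_region_def active_in_slot_def)

lemma has_opportunity_if_path_active:
  assumes valid: "valid_protocol Q"
    and path: "\<And>j. j < path_hops (secondary_side Q) S i \<Longrightarrow>
        occupied (secondary_side Q) S (path_cell (secondary_side Q) S i j) \<and>
        (\<exists>t < 25. in_active_region Q P (path_cell (secondary_side Q) S i j) t)"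
  shows "has_opportunity Q P S i"
  unfolding has_opportunity_def
proof
  fix u0
  let ?h = "path_hops (secondary_side Q) S i" and ?c = "path_cell (secondary_side Q) S i"
  obtain t where t: "t j < 25" "in_active_region Q P (?c j) (t j)" if "j < ?h" for j
    using path by metis
  define v where "v j = secondary_turn Q (fst (?c j) mod 5, snd (?c j) mod 5)" for j
  have v: "v j < 25" for j
  proof -
    have "(fst (?c j) mod 5, snd (?c j) mod 5) \<in> {0..<5} \<times> {0..<5}" by auto
    then show ?thesis
      using valid unfolding valid_protocol_def turn_order_def bij_betw_def v_def by fastforce
  qed
  \<comment> \<open>Hop \<open>j\<close> is given the primary frame \<open>u0 + j\<close>, the
    primary slot \<open>t j\<close> of that frame and the secondary slot \<open>v j\<close> inside
    it. One whole frame per hop makes \<open>u\<close> increase whatever the order of the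
    \<open>t j\<close>.\<close>
  define u where "u j = 25 * (25 * (u0 + j) + t j) + v j" for j
  have "u0 \<le> u 0" by (simp add: u_def)
  moreover have "u j < u (Suc j)" if "Suc j < ?h" for j
    using t(1)[of j] v[of j] that by (simp add: u_def)
  moreover have "may_transmit Q P (?c j) (u j)" if "j < ?h" for j
  proof -
    have "u j mod 25 = v j" "u j div 25 = 25 * (u0 + j) + t j"
      unfolding u_def using v[of j] by (simp_all only: mod_mult_self4 div_mult_self4 mod_less div_less)
    moreover have "in_active_region Q P (?c j) (25 * (u0 + j) + t j)"
      using t(2)[OF that] unfolding in_active_region_def active_region_periodic .
    ultimately show ?thesis
      by (simp add: may_transmit_def active_in_slot_def flip: v_def)
  qed
  ultimately show "\<exists>u. u0 \<le> u 0 \<and> (\<forall>j. Suc j < ?h \<longrightarrow> u j < u (Suc j)) \<and>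
      (\<forall>j < ?h. may_transmit Q P (?c j) (u j) \<and> occupied (secondary_side Q) S (?c j))"
    using path by blast
qed


section \<open>Measurability\<close>

text \<open>The protocols see a network only through these data of countable type, so every event
  about them is measurable.\<close>

definition cell_data :: "real \<Rightarrow> network \<Rightarrow> nat \<times> cell list \<times> nat list" where
  "cell_data s N =
     (num_nodes N, map (node_cell s N) [0..<num_nodes N], map (dest N) [0..<num_nodes N])"

lemma cell_data_eqD:
  assumes "cell_data s N = cell_data s N'"
  shows "num_nodes N' = num_nodes N"
    "i < num_nodes N \<Longrightarrow> node_cell s N' i = node_cell s N i"
    "i < num_nodes N \<Longrightarrow> dest N' i = dest N i"
proof -
  show k: "num_nodes N' = num_nodes N" using assms by (simp add: cell_data_def)
  have "map (node_cell s N') [0..<num_nodes N] = map (node_cell s N) [0..<num_nodes N]"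
    "map (dest N') [0..<num_nodes N] = map (dest N) [0..<num_nodes N]"
    using assms k by (simp_all add: cell_data_def)
  then show "i < num_nodes N \<Longrightarrow> node_cell s N' i = node_cell s N i"
    "i < num_nodes N \<Longrightarrow> dest N' i = dest N i"
    by simp_all
qed

section \<open>Notions that depend on a network through its cell data only\<close>

lemma occupied_cong:
  assumes "cell_data s N = cell_data s N'"
  shows "occupied s N' c = occupied s N c"
  using cell_data_eqD[OF assms] by (auto simp: occupied_def)

text \<open>A path reads the cell of the destination, and \<open>cell_data\<close> records cells
  only for labels below \<open>num_nodes\<close>; this is why the destination is assumed to be such
  a label.\<close>

lemma path_cong:
  assumes "cell_data s N = cell_data s N'" "i < num_nodes N" "dest N i < num_nodes N"
  shows "path_cell s N' i j = path_cell s N i j" "path_hops s N' i = path_hops s N i"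
  using cell_data_eqD[OF assms(1)] assms(2,3) by (simp_all add: path_cell_def path_hops_def)

lemma contains_TX_cong:
  assumes "cell_data s N = cell_data s N'" "\<And>i. i < num_nodes N \<Longrightarrow> dest N i < num_nodes N"
  shows "contains_TX s N' c = contains_TX s N c"
  unfolding contains_TX_def cell_data_eqD(1)[OF assms(1)] occupied_cong[OF assms(1)]
  by (simp add: path_cong[OF assms(1) _ assms(2)] cong: conj_cong)

lemma in_active_region_cong:
  assumes "cell_data (primary_side Q) N = cell_data (primary_side Q) N'"
    "\<And>i. i < num_nodes N \<Longrightarrow> dest N i < num_nodes N"
  shows "in_active_region Q N' c t = in_active_region Q N c t"
  using contains_TX_cong[OF assms] by (simp add: in_active_region_def active_region_def)

lemma opportunistic_factor_cong:
  assumes "cell_data (primary_side Q) N = cell_data (primary_side Q) N'"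
    "\<And>i. i < num_nodes N \<Longrightarrow> dest N i < num_nodes N"
  shows "opportunistic_factor Q N' c = opportunistic_factor Q N c"
  using in_active_region_cong[OF assms] by (simp add: opportunistic_factor_def)

lemma has_opportunity_cong:
  assumes "cell_data (primary_side Q) P = cell_data (primary_side Q) P'"
    "\<And>i. i < num_nodes P \<Longrightarrow> dest P i < num_nodes P"
    and S: "cell_data (secondary_side Q) S = cell_data (secondary_side Q) S'"
    "i < num_nodes S" "dest S i < num_nodes S"
  shows "has_opportunity Q P' S' i = has_opportunity Q P S i"
proof -
  have "in_active_region Q P' c t = in_active_region Q P c t" for c t
    using assms(1,2) by (rule in_active_region_cong)
  then show ?thesis
    unfolding has_opportunity_def may_transmit_def path_cong[OF S] occupied_cong[OF S(1)] by simp
qed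

section \<open>Measurability of the cell data of a random network\<close>

lemma sd_pairings_less:
  assumes "p \<in> sd_pairings k" "i < k"
  shows "p i < k"
  using assms permutes_in_image[of p "{..<k}" i] by (auto simp: sd_pairings_def)

text \<open>Functions on the naturals form an uncountable type, but \<open>dest\<close> takes only
  these values. An event about \<open>dest\<close> is thus a countable union of the events
  \<open>dest = p\<close>, which are measurable by assumption.\<close>

lemma countable_sd_pairings: "countable (\<Union>k. sd_pairings k)"
proof (rule countable_UN)
  fix k
  have "sd_pairings k \<subseteq> {p. p permutes {..<k}}" by (auto simp: sd_pairings_def)
  then show "countable (sd_pairings k)"
    by (rule countable_subset) (simp add: countable_finite finite_permutations)
qed simp

lemma unit_square_borel: "unit_square \<in> sets borel"
  unfolding unit_square_def by (intro borel_Times) auto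

lemma cell_square_borel: "cell_square s c \<in> sets borel"
  unfolding cell_square_def cell_block_def by (intro borel_Times) auto

lemma random_network_dest_less:
  assumes "random_network M d \<Phi>" "\<omega> \<in> space M" "i < num_nodes (\<Phi> \<omega>)"
  shows "dest (\<Phi> \<omega>) i < num_nodes (\<Phi> \<omega>)"
  using assms sd_pairings_less by (auto simp: random_network_def random_sd_pairing_def)

lemma random_network_pos:
  assumes "random_network M d \<Phi>" "\<omega> \<in> space M" "i < num_nodes (\<Phi> \<omega>)"
  shows "pos (\<Phi> \<omega>) i \<in> unit_square"
  using assms by (auto simp: random_network_def poisson_point_process_def)

text \<open>All nodes lie in the unit square, so the number of nodes is the Poisson count of the
  whole square.\<close>

lemma measurable_num_nodes:
  assumes "random_network M d \<Phi>"
  shows "(\<lambda>\<omega>. num_nodes (\<Phi> \<omega>)) \<in> measurable M (count_space UNIV)"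
proof -
  have "num_nodes (\<Phi> \<omega>) = node_count (\<Phi> \<omega>) unit_square" if "\<omega> \<in> space M" for \<omega>
  proof -
    have "{i. i < num_nodes (\<Phi> \<omega>) \<and> pos (\<Phi> \<omega>) i \<in> unit_square} = {..<num_nodes (\<Phi> \<omega>)}"
      using random_network_pos[OF assms that] by auto
    then show ?thesis by (simp add: node_count_def)
  qed
  moreover have "(\<lambda>\<omega>. node_count (\<Phi> \<omega>) unit_square) \<in> measurable M (count_space UNIV)"
    using assms unit_square_borel by (auto simp: random_network_def poisson_point_process_def)
  ultimately show ?thesis by (subst measurable_cong)
qed

lemma measurable_dest:
  assumes "random_network M d \<Phi>"
  shows "(\<lambda>\<omega>. dest (\<Phi> \<omega>) i) \<in> measurable M (count_space UNIV)"
proof (subst measurable_count_space_eq2_countable, safe)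
  fix j
  have "(\<lambda>\<omega>. dest (\<Phi> \<omega>) i) -` {j} \<inter> space M =
      (\<Union>p \<in> {p \<in> \<Union>k. sd_pairings k. p i = j}. {\<omega> \<in> space M. dest (\<Phi> \<omega>) = p})"
    using assms by (auto simp: random_network_def random_sd_pairing_def)
  also have "\<dots> \<in> sets M"
  proof (rule sets.countable_UN')
    show "countable {p \<in> \<Union>k. sd_pairings k. p i = j}"
      by (rule countable_subset[OF _ countable_sd_pairings]) blast
  qed (use assms in \<open>auto simp: random_network_def random_sd_pairing_def\<close>)
  finally show "(\<lambda>\<omega>. dest (\<Phi> \<omega>) i) -` {j} \<inter> space M \<in> sets M" .
qed auto

lemma measurable_node_cell:
  assumes "random_network M d \<Phi>"
  shows "(\<lambda>\<omega>. node_cell s (\<Phi> \<omega>) i) \<in> measurable M (count_space UNIV)"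
proof (subst measurable_count_space_eq2_countable, safe)
  fix c :: cell
  have pos: "(\<lambda>\<omega>. pos (\<Phi> \<omega>) i) \<in> borel_measurable M"
    using assms by (auto simp: random_network_def poisson_point_process_def)
  have [measurable]: "(\<lambda>\<omega>. fst (pos (\<Phi> \<omega>) i)) \<in> borel_measurable M"
    "(\<lambda>\<omega>. snd (pos (\<Phi> \<omega>) i)) \<in> borel_measurable M"
    using pos by (auto intro!: borel_measurable_continuous_on[of fst]
        borel_measurable_continuous_on[of snd] continuous_intros)
  have "{\<omega> \<in> space M. \<lfloor>fst (pos (\<Phi> \<omega>) i) / s\<rfloor> = fst c \<and> \<lfloor>snd (pos (\<Phi> \<omega>) i) / s\<rfloor> = snd c} \<in> sets M"
    by measurable
  also have "{\<omega> \<in> space M. \<lfloor>fst (pos (\<Phi> \<omega>) i) / s\<rfloor> = fst c \<and> \<lfloor>snd (pos (\<Phi> \<omega>) i) / s\<rfloor> = snd c} =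
      (\<lambda>\<omega>. node_cell s (\<Phi> \<omega>) i) -` {c} \<inter> space M"
    by (auto simp: node_cell_def cell_of_def)
  finally show "(\<lambda>\<omega>. node_cell s (\<Phi> \<omega>) i) -` {c} \<inter> space M \<in> sets M" .
qed auto

lemma measurable_cell_data:
  assumes "random_network M d \<Phi>"
  shows "(\<lambda>\<omega>. cell_data s (\<Phi> \<omega>)) \<in> measurable M (count_space UNIV)"
proof (subst measurable_count_space_eq2_countable, safe)
  fix k cs ds
  note [measurable] = measurable_num_nodes[OF assms] measurable_dest[OF assms]
    measurable_node_cell[OF assms]
  \<comment> \<open>With the lengths fixed to \<open>k\<close>, comparing the entries below
    \<open>k\<close> decides equality of the lists, which leaves finitely many measurable
    conditions.\<close>
  have "{\<omega> \<in> space M. num_nodes (\<Phi> \<omega>) = k \<and> length cs = k \<and> length ds = k \<and>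
      (\<forall>i \<in> {..<k}. node_cell s (\<Phi> \<omega>) i = cs ! i \<and> dest (\<Phi> \<omega>) i = ds ! i)} \<in> sets M"
    by measurable
  also have "{\<omega> \<in> space M. num_nodes (\<Phi> \<omega>) = k \<and> length cs = k \<and> length ds = k \<and>
      (\<forall>i \<in> {..<k}. node_cell s (\<Phi> \<omega>) i = cs ! i \<and> dest (\<Phi> \<omega>) i = ds ! i)} =
      (\<lambda>\<omega>. cell_data s (\<Phi> \<omega>)) -` {(k, cs, ds)} \<inter> space M"
    by (auto simp: cell_data_def list_eq_iff_nth_eq)
  finally show "(\<lambda>\<omega>. cell_data s (\<Phi> \<omega>)) -` {(k, cs, ds)} \<inter> space M \<in> sets M" .
qed auto

text \<open>Such an event is the preimage under \<open>X\<close> of its own image, and every set is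
  measurable in \<open>count_space UNIV\<close>. An implication suffices for \<open>det\<close>
  because the two outcomes can be exchanged.\<close>

lemma sets_if_determined_by:
  assumes X: "X \<in> measurable M (count_space UNIV)"
    and det: "\<And>\<omega> \<omega>'. \<omega> \<in> space M \<Longrightarrow> \<omega>' \<in> space M \<Longrightarrow> X \<omega> = X \<omega>' \<Longrightarrow> F \<omega> \<Longrightarrow> F \<omega>'"
  shows "{\<omega> \<in> space M. F \<omega>} \<in> sets M"
proof -
  have "{\<omega> \<in> space M. F \<omega>} = X -` (X ` {\<omega> \<in> space M. F \<omega>}) \<inter> space M"
  proof safe
    fix \<omega> \<omega>' assume "X \<omega> = X \<omega>'" "\<omega> \<in> space M" "\<omega>' \<in> space M" "F \<omega>'"
    then show "F \<omega>" using det[of \<omega>' \<omega>] by simp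
  qed auto
  also have "\<dots> \<in> sets M" using X by (rule measurable_sets) simp
  finally show ?thesis .
qed

text \<open>This joins the data of the two networks. With countable values it is enough to check
  single pairs, whose preimages are intersections of two events.\<close>

lemma measurable_Pair_countable:
  fixes X :: "'a \<Rightarrow> 'b :: countable" and Y :: "'a \<Rightarrow> 'c :: countable"
  assumes [measurable]: "X \<in> measurable M (count_space UNIV)" "Y \<in> measurable M (count_space UNIV)"
  shows "(\<lambda>\<omega>. (X \<omega>, Y \<omega>)) \<in> measurable M (count_space UNIV)"
proof (subst measurable_count_space_eq2_countable, safe)
  fix x y
  have "{\<omega> \<in> space M. X \<omega> = x \<and> Y \<omega> = y} \<in> sets M" by measurable
  then show "(\<lambda>\<omega>. (X \<omega>, Y \<omega>)) -` {(x, y)} \<inter> space M \<in> sets M"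
    by (simp add: vimage_def Int_def conj_commute)
qed auto


section \<open>Empty cells\<close>

lemma node_cell_eq_iff:
  assumes "s > 0"
  shows "node_cell s N i = c \<longleftrightarrow> pos N i \<in> cell_square s c"
  using assms
  by (auto simp: node_cell_def cell_of_def cell_square_def cell_block_def prod_eq_iff mem_Times_iff
      floor_eq_iff pos_le_divide_eq pos_divide_less_eq)

lemma occupied_iff_node_count:
  assumes "s > 0"
  shows "occupied s N c \<longleftrightarrow> node_count N (cell_square s c) \<noteq> 0"
  by (auto simp: occupied_def node_count_def node_cell_eq_iff[OF assms] card_eq_0_iff)

lemma measure_cell_square:
  assumes "s > 0"
  shows "measure lborel (cell_square s c) = s\<^sup>2"
proof -
  have "emeasure lborel (cell_square s c) = ennreal s * ennreal s"
    unfolding cell_square_def cell_block_def lborel_prod[symmetric]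
    using assms by (subst lborel.emeasure_pair_measure_Times) (auto simp: algebra_simps)
  then show ?thesis
    using assms by (simp add: measure_def enn2real_mult power2_eq_square)
qed

text \<open>Parametrised by the number of cells per side alone, so that it serves both the primary
  and the secondary grid.\<close>

definition all_cells_occupied :: "int \<Rightarrow> network \<Rightarrow> bool" where
  "all_cells_occupied g N \<longleftrightarrow> (\<forall>c \<in> grid_cells g. occupied (1 / of_int g) N c)"

text \<open>Union bound: the count in one of the \<open>g^2\<close> cells is Poisson with mean
  \<open>d / g^2\<close>, so that cell is empty with probability
  \<open>exp (- (d / g^2))\<close>.\<close>

lemma prob_all_cells_occupied:
  assumes "random_network M d \<Phi>" "g > 0"
  shows "{\<omega> \<in> space M. \<not> all_cells_occupied g (\<Phi> \<omega>)} \<in> sets M"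
    "measure M {\<omega> \<in> space M. \<not> all_cells_occupied g (\<Phi> \<omega>)} \<le>
       (of_int g)\<^sup>2 * exp (- (d / (of_int g)\<^sup>2))"
proof -
  let ?s = "1 / real_of_int g"
  interpret prob_space M
    using assms by (simp add: random_network_def poisson_point_process_def)
  define E where "E c = {\<omega> \<in> space M. node_count (\<Phi> \<omega>) (cell_square ?s c) = 0}" for c
  have s: "?s > 0" using assms by simp
  have fin: "finite (grid_cells g)" by (simp add: grid_cells_def)
  have sub: "cell_square ?s c \<subseteq> unit_square" if "c \<in> grid_cells g" for c
    using cell_square_subset_unit_square[OF that] .
  have E: "E c \<in> sets M" "measure M (E c) = exp (- (d / (of_int g)\<^sup>2))" if "c \<in> grid_cells g" for c
  proof -
    \<comment> \<open>The second fact is the Poisson formula at count 0, kept unsimplified to match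
      the definition.\<close>
    have PP: "(\<lambda>\<omega>. node_count (\<Phi> \<omega>) (cell_square ?s c)) \<in> measurable M (count_space UNIV)"
      "measure M (E c) = (d * measure lborel (cell_square ?s c)) ^ 0 / fact 0 *
        exp (- (d * measure lborel (cell_square ?s c)))"
      using assms(1) cell_square_borel[of ?s c] sub[OF that]
      unfolding random_network_def poisson_point_process_def E_def by blast+
    note [measurable] = PP(1)
    show "E c \<in> sets M" unfolding E_def by measurable
    show "measure M (E c) = exp (- (d / (of_int g)\<^sup>2))"
      using PP(2) by (simp add: measure_cell_square[OF s] power_divide)
  qed
  have eq: "{\<omega> \<in> space M. \<not> all_cells_occupied g (\<Phi> \<omega>)} = (\<Union>c \<in> grid_cells g. E c)"
    by (auto simp: all_cells_occupied_def E_def occupied_iff_node_count[OF s])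
  show "{\<omega> \<in> space M. \<not> all_cells_occupied g (\<Phi> \<omega>)} \<in> sets M"
    unfolding eq using E(1) fin by blast
  have "measure M (\<Union>c \<in> grid_cells g. E c) \<le> (\<Sum>c \<in> grid_cells g. measure M (E c))"
    using E(1) fin by (intro finite_measure_subadditive_finite) auto
  also have "\<dots> = (of_int g)\<^sup>2 * exp (- (d / (of_int g)\<^sup>2))"
    using E(2) assms(2) by (simp add: grid_cells_def card_cartesian_product power2_eq_square)
  finally show "measure M {\<omega> \<in> space M. \<not> all_cells_occupied g (\<Phi> \<omega>)} \<le>
       (of_int g)\<^sup>2 * exp (- (d / (of_int g)\<^sup>2))" unfolding eq .
qed

text \<open>Rounding the cells per side down helps twice: it bounds the number of cells by
  \<open>d / ln d\<close>, and it raises the mean count per cell to at least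
  \<open>k * ln d\<close>, so that a cell is empty with probability at most \<open>1 / d\<close>.
  The factor \<open>1 / ln d\<close> that remains is what makes \<open>k = 1\<close>
  admissible.\<close>

lemma empty_cell_bound:
  assumes "k \<ge> 1" "d > 1" "cells_per_side k d > 0"
  defines "g \<equiv> real_of_int (cells_per_side k d)"
  shows "g\<^sup>2 * exp (- (d / g\<^sup>2)) \<le> 1 / ln d"
proof -
  define q where "q = k * ln d / d"
  have ln: "ln d > 0" using assms by simp
  then have q: "q > 0" using assms unfolding q_def by simp
  have g: "g > 0" using assms by simp
  have "5 * of_int \<lfloor>1 / (5 * sqrt q)\<rfloor> \<le> 5 * (1 / (5 * sqrt q))"
    by (intro mult_left_mono of_int_floor_le) simp
  then have "g \<le> 1 / sqrt q" unfolding g_def cells_per_side_def q_def by simp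
  then have "g\<^sup>2 \<le> (1 / sqrt q)\<^sup>2" using g by (intro power_mono) auto
  also have "\<dots> = 1 / q" using q by (simp add: power_divide)
  finally have gq: "g\<^sup>2 \<le> 1 / q" .
  then have "q \<le> 1 / g\<^sup>2" using g q by (simp add: field_simps)
  then have "d * q \<le> d / g\<^sup>2" using assms(2) mult_left_mono[of q "1 / g\<^sup>2" d] by simp
  moreover have "d * q = k * ln d" using assms(2) by (simp add: q_def)
  moreover have "ln d \<le> k * ln d" using assms(1) ln by simp
  ultimately have "exp (- (d / g\<^sup>2)) \<le> exp (- ln d)" by simp
  also have "\<dots> = 1 / d" using assms(2) by (simp add: exp_minus field_simps)
  finally have e: "exp (- (d / g\<^sup>2)) \<le> 1 / d" .
  have "1 / q = d / (k * ln d)" by (simp add: q_def)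
  also have "\<dots> \<le> d / ln d"
    using \<open>ln d \<le> k * ln d\<close> ln assms(1,2) by (intro divide_left_mono) auto
  finally have "g\<^sup>2 \<le> d / ln d" using gq by linarith
  then have "g\<^sup>2 * exp (- (d / g\<^sup>2)) \<le> d / ln d * (1 / d)"
    using e ln assms(2) by (intro mult_mono) auto
  then show ?thesis using assms(2) by simp
qed

lemma prob_some_cell_empty_tendsto_0:
  fixes d :: "nat \<Rightarrow> real"
  assumes "\<And>n. random_network (M n) (d n) (\<Phi> n)" "k \<ge> 1"
    and d: "filterlim d at_top sequentially"
    and g: "\<forall>\<^sub>F n in sequentially. cells_per_side k (d n) > 0"
  shows "(\<lambda>n. measure (M n)
     {\<omega> \<in> space (M n). \<not> all_cells_occupied (cells_per_side k (d n)) (\<Phi> n \<omega>)}) \<longlonglongrightarrow> 0"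
proof (rule tendsto_sandwich[OF _ _ tendsto_const])
  show "(\<lambda>n. 1 / ln (d n)) \<longlonglongrightarrow> 0"
    using filterlim_compose[OF ln_at_top d]
    by (intro real_tendsto_divide_at_top[of _ 1]) auto
  have "\<forall>\<^sub>F n in sequentially. d n > 1" using d by (simp add: filterlim_at_top_dense)
  then show "\<forall>\<^sub>F n in sequentially. measure (M n)
     {\<omega> \<in> space (M n). \<not> all_cells_occupied (cells_per_side k (d n)) (\<Phi> n \<omega>)} \<le> 1 / ln (d n)"
    using g
  proof eventually_elim
    case (elim n)
    show ?case
      using prob_all_cells_occupied(2)[OF assms(1) elim(2), of n]
        empty_cell_bound[OF assms(2) elim] by linarith
  qed
qed auto

text \<open>\<open>B\<close> is a bad event outside of which \<open>F\<close> holds. A set that is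
  not measurable has \<open>measure\<close> 0 by default, so measurability of the event
  \<open>F\<close> itself has to be supplied.\<close>

lemma whpI:
  assumes "\<And>n. prob_space (M n)"
    and F: "\<forall>\<^sub>F n in sequentially. {\<omega> \<in> space (M n). F n \<omega>} \<in> sets (M n) \<and>
      B n \<in> sets (M n) \<and> (\<forall>\<omega> \<in> space (M n) - B n. F n \<omega>)"
    and B: "(\<lambda>n. measure (M n) (B n)) \<longlonglongrightarrow> 0"
  shows "whp M F"
  unfolding whp_def
proof (rule tendsto_sandwich[OF _ _ _ tendsto_const])
  have "(\<lambda>n. 1 - measure (M n) (B n)) \<longlonglongrightarrow> 1 - 0" by (intro tendsto_intros B)
  then show "(\<lambda>n. 1 - measure (M n) (B n)) \<longlonglongrightarrow> 1" by simp
  show "\<forall>\<^sub>F n in sequentially. measure (M n) {\<omega> \<in> space (M n). F n \<omega>} \<le> 1"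
    using assms(1) by (simp add: prob_space.prob_le_1)
  show "\<forall>\<^sub>F n in sequentially. 1 - measure (M n) (B n) \<le> measure (M n) {\<omega> \<in> space (M n). F n \<omega>}"
    using F
  proof eventually_elim
    case (elim n)
    interpret prob_space "M n" by fact
    have "1 - measure (M n) (B n) = measure (M n) (space (M n) - B n)"
      using elim by (simp add: prob_compl)
    also have "\<dots> \<le> measure (M n) {\<omega> \<in> space (M n). F n \<omega>}"
      using elim by (intro finite_measure_mono) auto
    finally show ?case .
  qed
qed


section \<open>Asymptotics of the grids\<close>

text \<open>The ratio of the unrounded cell counts per side is
  \<open>n powr ((\<beta> - 1) / 2) / sqrt \<beta>\<close>, which is unbounded. The factor 5 is the
  one required by \<open>near_cell_index\<close>.\<close>

lemma eventually_cells_per_side: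
  fixes k \<beta> :: real
  assumes "k \<ge> 1" "\<beta> > 1"
  shows "\<forall>\<^sub>F n in sequentially. cells_per_side k (real n) > 0 \<and>
    5 * cells_per_side k (real n) < cells_per_side k (real n powr \<beta>)"
proof -
  define f where "f d = 1 / (5 * sqrt (k * ln d / d))" for d
  have "\<forall>\<^sub>F n in sequentially. f (real n) \<ge> 1"
    unfolding f_def using assms by real_asymp
  \<comment> \<open>The extra 1 makes the inequality strict after both sides are rounded
    down.\<close>
  moreover have "\<forall>\<^sub>F n in sequentially. 5 * f (real n) + 1 \<le> f (real n powr \<beta>)"
    unfolding f_def using assms by real_asymp
  ultimately show ?thesis
  proof eventually_elim
    case (elim n)
    have "1 \<le> \<lfloor>f (real n)\<rfloor>" "5 * \<lfloor>f (real n)\<rfloor> < \<lfloor>f (real n powr \<beta>)\<rfloor>"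
      using elim by linarith+
    then show ?case by (simp add: cells_per_side_def f_def)
  qed
qed

text \<open>A primary cell without a transmitter has no preservation region, so the upper bound may
  fail near it. Hence it is given for each outcome in which all primary cells transmit, and w.h.p.
  without that condition.\<close>

theorem lemma5:
  fixes \<beta> k1 k2 :: real
    and M :: "nat \<Rightarrow> 'w measure"
    and P S :: "nat \<Rightarrow> 'w \<Rightarrow> network"
    and Q :: "nat \<Rightarrow> protocol"
  assumes "\<beta> > 1" and "k1 \<ge> 1" and "k2 = k1"
    and "\<And>n. random_network (M n) (real n) (P n)"
    and "\<And>n. random_network (M n) (real n powr \<beta>) (S n)"
    and "\<And>n. valid_protocol (Q n)"
    and "\<And>n. primary_const (Q n) = k1" and "\<And>n. primary_density (Q n) = real n"
    and "\<And>n. secondary_const (Q n) = k2" and "\<And>n. secondary_density (Q n) = real n powr \<beta>"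
  shows "(\<forall>\<^sub>F n in sequentially. \<forall>\<omega> \<in> space (M n). \<forall>c \<in> secondary_cells (Q n).
            9 / 25 \<le> opportunistic_factor (Q n) (P n \<omega>) c \<and>
            (off_boundary (Q n) c \<and>
             (\<forall>p \<in> primary_cells (Q n). contains_TX (primary_side (Q n)) (P n \<omega>) p) \<longrightarrow>
               opportunistic_factor (Q n) (P n \<omega>) c \<le> 16 / 25)) \<and>
         whp M (\<lambda>n \<omega>. \<forall>c \<in> secondary_cells (Q n).
            9 / 25 \<le> opportunistic_factor (Q n) (P n \<omega>) c \<and>
            (off_boundary (Q n) c \<longrightarrow> opportunistic_factor (Q n) (P n \<omega>) c \<le> 16 / 25)) \<and>
         whp M (\<lambda>n \<omega>. (\<forall>i < num_nodes (S n \<omega>). has_opportunity (Q n) (P n \<omega>) (S n \<omega>) i) \<and>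
            outage_probability (Q n) (P n \<omega>) (S n \<omega>) = 0)"
proof -
  define G where "G n = cells_per_side k1 (real n)" for n
  define g where "g n = cells_per_side k1 (real n powr \<beta>)" for n
  have prob: "prob_space (M n)" for n
    using assms(4) by (auto simp: random_network_def poisson_point_process_def)
  have side: "primary_side (Q n) = 1 / of_int (G n)" "secondary_side (Q n) = 1 / of_int (g n)"
    and cells: "primary_cells (Q n) = grid_cells (G n)" "secondary_cells (Q n) = grid_cells (g n)" for n
    using assms(3,7-10)
    by (simp_all add: primary_side_def secondary_side_def cell_side_def primary_cells_def
        secondary_cells_def G_def g_def)
  have large: "\<forall>\<^sub>F n in sequentially. 0 < G n \<and> 5 * G n < g n"
    using eventually_cells_per_side[OF assms(2,1)] by (simp add: G_def g_def)
  have bounds: "9 / 25 \<le> opportunistic_factor (Q n) N c"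
      "off_boundary (Q n) c \<Longrightarrow> \<forall>p \<in> primary_cells (Q n). contains_TX (primary_side (Q n)) N p \<Longrightarrow>
        opportunistic_factor (Q n) N c \<le> 16 / 25"
    if "0 < G n \<and> 5 * G n < g n" "c \<in> secondary_cells (Q n)" for n N c
  proof -
    \<comment> \<open>Both sides are reciprocals of cell counts, so five times as many secondary
      cells per side means \<open>5 * s < a\<close>.\<close>
    have "real_of_int (5 * G n) < of_int (g n)" using that(1) by (simp only: of_int_less_iff)
    then have "0 < primary_side (Q n)" "0 < secondary_side (Q n)"
      "5 * secondary_side (Q n) < primary_side (Q n)"
      using that(1) by (simp_all add: side field_simps)
    then show "9 / 25 \<le> opportunistic_factor (Q n) N c"
      "off_boundary (Q n) c \<Longrightarrow> \<forall>p \<in> primary_cells (Q n). contains_TX (primary_side (Q n)) N p \<Longrightarrow>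
        opportunistic_factor (Q n) N c \<le> 16 / 25"
      using that(2) assms(6) opportunistic_factor_ge opportunistic_factor_le by blast+
  qed
  note P_less = random_network_dest_less[OF assms(4)] and S_less = random_network_dest_less[OF assms(5)]

  have part1: "\<forall>\<^sub>F n in sequentially. \<forall>\<omega> \<in> space (M n). \<forall>c \<in> secondary_cells (Q n).
      9 / 25 \<le> opportunistic_factor (Q n) (P n \<omega>) c \<and>
      (off_boundary (Q n) c \<and>
       (\<forall>p \<in> primary_cells (Q n). contains_TX (primary_side (Q n)) (P n \<omega>) p) \<longrightarrow>
         opportunistic_factor (Q n) (P n \<omega>) c \<le> 16 / 25)"
    using large by eventually_elim (use bounds in blast)

  \<comment> \<open>The bad event is an empty primary cell; otherwise every primary cell contains a
    source and hence a transmitter.\<close>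
  have part2: "whp M (\<lambda>n \<omega>. \<forall>c \<in> secondary_cells (Q n).
      9 / 25 \<le> opportunistic_factor (Q n) (P n \<omega>) c \<and>
      (off_boundary (Q n) c \<longrightarrow> opportunistic_factor (Q n) (P n \<omega>) c \<le> 16 / 25))"
  proof (rule whpI[OF prob])
    show "(\<lambda>n. measure (M n) {\<omega> \<in> space (M n). \<not> all_cells_occupied (G n) (P n \<omega>)}) \<longlonglongrightarrow> 0"
      unfolding G_def
    proof (rule prob_some_cell_empty_tendsto_0[OF assms(4) assms(2)])
      show "\<forall>\<^sub>F n in sequentially. 0 < cells_per_side k1 (real n)"
        using large by eventually_elim (simp add: G_def)
    qed (rule filterlim_real_sequentially)
    show "\<forall>\<^sub>F n in sequentially.
      {\<omega> \<in> space (M n). \<forall>c \<in> secondary_cells (Q n).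
          9 / 25 \<le> opportunistic_factor (Q n) (P n \<omega>) c \<and>
          (off_boundary (Q n) c \<longrightarrow> opportunistic_factor (Q n) (P n \<omega>) c \<le> 16 / 25)} \<in> sets (M n) \<and>
      {\<omega> \<in> space (M n). \<not> all_cells_occupied (G n) (P n \<omega>)} \<in> sets (M n) \<and>
      (\<forall>\<omega> \<in> space (M n) - {\<omega> \<in> space (M n). \<not> all_cells_occupied (G n) (P n \<omega>)}.
        \<forall>c \<in> secondary_cells (Q n). 9 / 25 \<le> opportunistic_factor (Q n) (P n \<omega>) c \<and>
          (off_boundary (Q n) c \<longrightarrow> opportunistic_factor (Q n) (P n \<omega>) c \<le> 16 / 25))"
      using large
    proof eventually_elim
      case (elim n)
      have "{\<omega> \<in> space (M n). \<forall>c \<in> secondary_cells (Q n).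
          9 / 25 \<le> opportunistic_factor (Q n) (P n \<omega>) c \<and>
          (off_boundary (Q n) c \<longrightarrow> opportunistic_factor (Q n) (P n \<omega>) c \<le> 16 / 25)} \<in> sets (M n)"
      proof (rule sets_if_determined_by[OF measurable_cell_data[OF assms(4), of "primary_side (Q n)"]])
        fix \<omega> \<omega>'
        assume \<omega>: "\<omega> \<in> space (M n)"
          and eq: "cell_data (primary_side (Q n)) (P n \<omega>) = cell_data (primary_side (Q n)) (P n \<omega>')"
          and *: "\<forall>c \<in> secondary_cells (Q n). 9 / 25 \<le> opportunistic_factor (Q n) (P n \<omega>) c \<and>
            (off_boundary (Q n) c \<longrightarrow> opportunistic_factor (Q n) (P n \<omega>) c \<le> 16 / 25)"
        have "opportunistic_factor (Q n) (P n \<omega>') c = opportunistic_factor (Q n) (P n \<omega>) c" for c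
          using eq P_less[OF \<omega>] by (rule opportunistic_factor_cong)
        with * show "\<forall>c \<in> secondary_cells (Q n). 9 / 25 \<le> opportunistic_factor (Q n) (P n \<omega>') c \<and>
            (off_boundary (Q n) c \<longrightarrow> opportunistic_factor (Q n) (P n \<omega>') c \<le> 16 / 25)"
          by simp
      qed
      moreover have "contains_TX (primary_side (Q n)) (P n \<omega>) p"
        if "all_cells_occupied (G n) (P n \<omega>)" "p \<in> primary_cells (Q n)" for \<omega> p
        using that by (auto simp: all_cells_occupied_def side cells intro: contains_TX_if_occupied)
      ultimately show ?case
        using bounds[OF elim] prob_all_cells_occupied(1)[OF assms(4) conjunct1[OF elim]]
        by blast
    qed
  qed

  \<comment> \<open>The bad event is an empty secondary cell. The primary network enters only
    through the lower bound 9/25, which holds for all of its realizations.\<close>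
  have part3: "whp M (\<lambda>n \<omega>. \<forall>i < num_nodes (S n \<omega>). has_opportunity (Q n) (P n \<omega>) (S n \<omega>) i)"
  proof (rule whpI[OF prob])
    show "(\<lambda>n. measure (M n) {\<omega> \<in> space (M n). \<not> all_cells_occupied (g n) (S n \<omega>)}) \<longlonglongrightarrow> 0"
      unfolding g_def
    proof (rule prob_some_cell_empty_tendsto_0[OF assms(5) assms(2)])
      show "\<forall>\<^sub>F n in sequentially. 0 < cells_per_side k1 (real n powr \<beta>)"
        using large by eventually_elim (simp add: g_def)
      show "filterlim (\<lambda>n. real n powr \<beta>) at_top sequentially"
        using assms(1) by real_asymp
    qed
    show "\<forall>\<^sub>F n in sequentially.
      {\<omega> \<in> space (M n). \<forall>i < num_nodes (S n \<omega>). has_opportunity (Q n) (P n \<omega>) (S n \<omega>) i} \<in> sets (M n) \<and>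
      {\<omega> \<in> space (M n). \<not> all_cells_occupied (g n) (S n \<omega>)} \<in> sets (M n) \<and>
      (\<forall>\<omega> \<in> space (M n) - {\<omega> \<in> space (M n). \<not> all_cells_occupied (g n) (S n \<omega>)}.
        \<forall>i < num_nodes (S n \<omega>). has_opportunity (Q n) (P n \<omega>) (S n \<omega>) i)"
      using large
    proof eventually_elim
      case (elim n)
      have g0: "0 < g n" using elim by linarith
      \<comment> \<open>The opportunity of a node depends on both networks, hence the pair of cell
        data.\<close>
      have "{\<omega> \<in> space (M n). \<forall>i < num_nodes (S n \<omega>). has_opportunity (Q n) (P n \<omega>) (S n \<omega>) i} \<in> sets (M n)"
      proof (rule sets_if_determined_by[OF measurable_Pair_countable[OF
            measurable_cell_data[OF assms(4), of "primary_side (Q n)"]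
            measurable_cell_data[OF assms(5), of "secondary_side (Q n)"]]], safe)
        fix \<omega> \<omega>' i
        assume \<omega>: "\<omega> \<in> space (M n)" and i: "i < num_nodes (S n \<omega>')"
          and eq: "cell_data (primary_side (Q n)) (P n \<omega>) = cell_data (primary_side (Q n)) (P n \<omega>')"
            "cell_data (secondary_side (Q n)) (S n \<omega>) = cell_data (secondary_side (Q n)) (S n \<omega>')"
          and *: "\<forall>i < num_nodes (S n \<omega>). has_opportunity (Q n) (P n \<omega>) (S n \<omega>) i"
        have "i < num_nodes (S n \<omega>)" using i cell_data_eqD(1)[OF eq(2)] by simp
        then show "has_opportunity (Q n) (P n \<omega>') (S n \<omega>') i"
          using * has_opportunity_cong[OF eq(1) P_less[OF \<omega>] eq(2) _ S_less[OF \<omega>]] by blast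
      qed
      moreover have "has_opportunity (Q n) (P n \<omega>) (S n \<omega>) i"
        if \<omega>: "\<omega> \<in> space (M n)" and occ: "all_cells_occupied (g n) (S n \<omega>)"
          and i: "i < num_nodes (S n \<omega>)" for \<omega> i
      proof (rule has_opportunity_if_path_active[OF assms(6)])
        fix j
        let ?c = "path_cell (secondary_side (Q n)) (S n \<omega>) i j"
        have "node_cell (secondary_side (Q n)) (S n \<omega>) l \<in> grid_cells (g n)"
          if "l < num_nodes (S n \<omega>)" for l
        proof -
          have x: "pos (S n \<omega>) l \<in> unit_square" using random_network_pos[OF assms(5) \<omega> that] .
          have "0 \<le> y / secondary_side (Q n)" "y / secondary_side (Q n) < of_int (g n)"
            if "0 \<le> y" "y < 1" for y
            using that g0 by (simp_all add: side)
          then show ?thesis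
            using x by (auto simp: node_cell_def cell_of_def grid_cells_def unit_square_def
                floor_less_iff)
        qed
        then have c: "?c \<in> grid_cells (g n)"
          using i S_less[OF \<omega> i] by (intro path_cell_in_grid) auto
        then have "9 / 25 \<le> opportunistic_factor (Q n) (P n \<omega>) ?c"
          using bounds(1)[OF elim] by (simp add: cells)
        \<comment> \<open>A positive opportunistic factor leaves at least one usable slot per
          primary frame in every cell of the path.\<close>
        then have "{t. t < 25 \<and> in_active_region (Q n) (P n \<omega>) ?c t} \<noteq> {}"
          by (intro notI) (simp add: opportunistic_factor_def)
        then show "occupied (secondary_side (Q n)) (S n \<omega>) ?c \<and>
            (\<exists>t < 25. in_active_region (Q n) (P n \<omega>) ?c t)"
          using occ c by (auto simp: all_cells_occupied_def side)
      qed
      ultimately show ?case using prob_all_cells_occupied(1)[OF assms(5) g0] by auto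
    qed
  qed
  \<comment> \<open>This also covers an empty secondary network, where the quotient is
    \<open>0 / 0 = 0\<close>. The event in the last conjunct thus coincides with the one treated in
    \<open>part3\<close>.\<close>
  have "outage_probability (Q n) (P n \<omega>) (S n \<omega>) = 0"
    if "\<forall>i < num_nodes (S n \<omega>). has_opportunity (Q n) (P n \<omega>) (S n \<omega>) i" for n \<omega>
  proof -
    have "{i. i < num_nodes (S n \<omega>) \<and> \<not> has_opportunity (Q n) (P n \<omega>) (S n \<omega>) i} = {}"
      using that by blast
    then show ?thesis by (simp only: outage_probability_def) simp
  qed
  then have outage: "(\<forall>i < num_nodes (S n \<omega>). has_opportunity (Q n) (P n \<omega>) (S n \<omega>) i) \<and>
        outage_probability (Q n) (P n \<omega>) (S n \<omega>) = 0 \<longleftrightarrow>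
      (\<forall>i < num_nodes (S n \<omega>). has_opportunity (Q n) (P n \<omega>) (S n \<omega>) i)" for n \<omega>
    by blast
  show ?thesis unfolding outage using part1 part2 part3 by blast
qed

end
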